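(* Let $\alpha\geq 2$, $k\geq 3$ be integers with $k\geq\alpha$. Then $$f(\alpha+k,\alpha,k)=\alpha k+m(k,k-\alpha).$$ Equivalently, $$f(\alpha+k,\alpha,k)=\begin{cases} k^2,&\alpha=k,\\ k^2-1,&\alpha=k-1,\\ \left\lceil\dfrac{k(\alpha+k)}{2}\right\rceil,&2\leq\alpha\leq k-2.\end{cases}$$
   Context: All graphs are finite, simple, and undirected. A graph is $k$-connected if it has more than $k$ vertices and deleting any set of fewer than $k$ vertices leaves a connected graph. The independence number of a graph is the maximum cardinality of a set of pairwise nonadjacent vertices; the size of a graph is its number of edges. For integers $n,\alpha,k$ for which the class of $k$-connected graphs of order $n$ and independence number (exactly) $\alpha$ is nonempty, $f(n,\alpha,k)$ denotes the minimum size of a graph in this class. For integers $p\geq 2$ and $0\leq d\leq p-1$, $m(p,d)$ denotes the minimum size of a graph of order $p$ that is $d$-connected, with the convention that no condition is imposed when $d=0$ (so $m(p,0)=0$). *)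

theory Defs
  imports Complex_Main "Graph_Theory.Digraph_Component"
begin

text \<open>
  A finite simple undirected graph is a \<^const>\<open>pair_graph\<close>: an irreflexive symmetric finite arc
  relation on a finite vertex set. Each undirected edge is represented by two opposite arcs, so the
  size counts unordered pairs rather than arcs.
\<close>

definition graph_size :: "'a pair_pre_digraph \<Rightarrow> nat" where
  "graph_size G = card ((\<lambda>(u, v). {u, v}) ` parcs G)"

definition independent_set :: "'a pair_pre_digraph \<Rightarrow> 'a set \<Rightarrow> bool" where
  "independent_set G S \<longleftrightarrow> S \<subseteq> pverts G \<and> (\<forall>u\<in>S. \<forall>v\<in>S. (u, v) \<notin> parcs G)"

definition independence_number :: "'a pair_pre_digraph \<Rightarrow> nat" where
  "independence_number G = Max (card ` {S. independent_set G S})"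

text \<open>For \<open>k = 0\<close> the following only says that the graph has a vertex.\<close>

definition k_connected :: "nat \<Rightarrow> 'a pair_pre_digraph \<Rightarrow> bool" where
  "k_connected k G \<longleftrightarrow> card (pverts G) > k \<and>
     (\<forall>S \<subseteq> pverts G. card S < k \<longrightarrow> connected (with_proj G \<restriction> (pverts G - S)))"

text \<open>
  Vertices are natural numbers; since the vertex set is an arbitrary finite set, every finite
  graph has an isomorphic copy of this kind.
\<close>

definition conn_class :: "nat \<Rightarrow> nat \<Rightarrow> nat pair_pre_digraph set" where
  "conn_class p d = {G. pair_graph G \<and> card (pverts G) = p \<and> k_connected d G}"

definition conn_indep_class :: "nat \<Rightarrow> nat \<Rightarrow> nat \<Rightarrow> nat pair_pre_digraph set" where
  "conn_indep_class n \<alpha> k = {G \<in> conn_class n k. independence_number G = \<alpha>}"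

text \<open>
  \<open>min_size_indep n \<alpha> k\<close> is the paper's \<open>f(n, \<alpha>, k)\<close> and \<open>min_size_conn p d\<close> is its \<open>m(p, d)\<close>.
  The infima are minima of sets of natural numbers and are attained whenever the class in
  question is nonempty; they are meaningful only in that case.
\<close>

definition min_size_indep :: "nat \<Rightarrow> nat \<Rightarrow> nat \<Rightarrow> nat" where
  "min_size_indep n \<alpha> k = Inf (graph_size ` conn_indep_class n \<alpha> k)"

definition min_size_conn :: "nat \<Rightarrow> nat \<Rightarrow> nat" where
  "min_size_conn p d = Inf (graph_size ` conn_class p d)"

text \<open>The complete graph witnesses that \<^term>\<open>min_size_conn p d\<close> is a genuine minimum for \<open>d < p\<close>.\<close>

lemma conn_class_nonempty:
  assumes "d < p"
  shows "conn_class p d \<noteq> {}"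
proof -
  define G :: "nat pair_pre_digraph" where
    "G = \<lparr>pverts = {..<p}, parcs = {(u, v). u < p \<and> v < p \<and> u \<noteq> v}\<rparr>"
  have fin: "finite {(u::nat, v). u < p \<and> v < p \<and> u \<noteq> v}"
    by (rule finite_subset[of _ "{..<p} \<times> {..<p}"]) auto
  have graph: "pair_graph G"
    by unfold_locales (auto simp: G_def fin symmetric_def intro!: symI)
  have "connected (with_proj G \<restriction> (pverts G - S))" if "S \<subseteq> pverts G" "card S < d" for S
  proof -
    let ?H = "with_proj (mk_symmetric (with_proj G \<restriction> (pverts G - S)))"
    have "card S < card (pverts G)"
      using that assms by (simp add: G_def)
    then have nonempty: "pverts G - S \<noteq> {}"
      using that(1) by auto
    have verts: "verts ?H = pverts G - S"
      by (simp add: mk_symmetric_def)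
    have "u \<rightarrow>\<^sup>*\<^bsub>?H\<^esub> v" if "u \<in> verts ?H" "v \<in> verts ?H" for u v
    proof (cases "u = v")
      case True
      then show ?thesis using that by (simp add: reachable_def rtrancl_on_refl)
    next
      case False
      then have "(u, v) \<in> arcs_ends ?H"
        using that unfolding verts
        by (force simp: mk_symmetric_def G_def)
      then show ?thesis using that
        by (auto simp: reachable_def intro: rtrancl_on_into_rtrancl_on rtrancl_on_refl)
    qed
    then show ?thesis
      using nonempty verts by (auto simp: connected_def strongly_connected_def)
  qed
  then have "k_connected d G"
    using assms by (simp add: k_connected_def G_def)
  then have "G \<in> conn_class p d"
    using graph by (simp add: conn_class_def G_def)
  then show ?thesis by blast
qed

end

theory Submission
  imports Defs
begin

text \<open>
  In a \<open>k\<close>-connected graph of order \<open>\<alpha> + k\<close> every vertex of an independent set \<open>S\<close> of size \<open>\<alpha>\<close> has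
  degree at least \<open>k\<close>, so it is adjacent to all \<open>k\<close> vertices outside \<open>S\<close>; deleting \<open>S\<close> leaves a
  \<open>(k - \<alpha>)\<close>-connected graph on these \<open>k\<close> vertices. Conversely, the join of such a graph with \<open>\<alpha>\<close>
  independent vertices is \<open>k\<close>-connected, and its independence number is \<open>\<alpha>\<close> because minimum degree
  \<open>k - \<alpha>\<close> bounds the independent sets of the smaller graph. The values of \<open>m\<close> come from the empty
  graph, the star and the Harary graphs.
\<close>

section \<open>Connectivity and edge counts\<close>

lemma pair_graph_iff:
  "pair_graph G \<longleftrightarrow> finite (pverts G) \<and> parcs G \<subseteq> pverts G \<times> pverts G \<and>
     sym (parcs G) \<and> irrefl (parcs G)" (is "_ \<longleftrightarrow> ?R")
proof
  assume "pair_graph G"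
  then interpret pair_graph G .
  have "(a, a) \<notin> parcs G" for a
    using pair_no_loops[of "(a, a)"] by auto
  then show ?R
    using pair_finite_verts pair_sym_arcs
    by (auto simp: symmetric_def irrefl_def dest: in_arcsD1 in_arcsD2)
next
  assume R: ?R
  then have "finite (parcs G)"
    by (meson finite_SigmaI finite_subset)
  with R show "pair_graph G"
    by unfold_locales (auto simp: symmetric_def irrefl_def)
qed

text \<open>Connectivity is phrased through cuts instead of walks: deletions and separations then
  become statements about a single crossing arc. For a symmetric relation it is the usual notion, as
  the next lemmas show.\<close>

definition cut_connected :: "'a rel \<Rightarrow> 'a set \<Rightarrow> bool" where
  "cut_connected E W \<longleftrightarrow> W \<noteq> {} \<and>
     (\<forall>U. U \<subseteq> W \<and> U \<noteq> {} \<and> U \<noteq> W \<longrightarrow> (\<exists>x\<in>U. \<exists>y\<in>W - U. (x, y) \<in> E))"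

lemma cut_connected_cong:
  assumes "\<And>x y. x \<in> W \<Longrightarrow> y \<in> W \<Longrightarrow> (x, y) \<in> E \<longleftrightarrow> (x, y) \<in> F"
  shows "cut_connected E W \<longleftrightarrow> cut_connected F W"
  unfolding cut_connected_def using assms by (smt (verit) DiffD1 subsetD)

text \<open>A walk cannot leave a set that no arc leaves; conversely, the set of vertices reachable
  from \<open>u\<close> is left by no arc, so it must be all of \<open>W\<close>. Symmetry makes the
  symmetric closure in the definition of connectedness harmless.\<close>

lemma connected_induce_iff:
  assumes "sym (parcs G)"
  shows "connected (with_proj G \<restriction> W) \<longleftrightarrow> cut_connected (parcs G) W"
proof -
  let ?H = "with_proj (mk_symmetric (with_proj G \<restriction> W))"
  let ?E = "{(u, v). (u, v) \<in> parcs G \<and> u \<in> W \<and> v \<in> W}"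
  have verts: "verts ?H = W" by simp
  have arcs: "arcs_ends ?H = ?E"
    using assms by (force simp: mk_symmetric_def induce_subgraph_def sym_def)
  have conn: "connected (with_proj G \<restriction> W) \<longleftrightarrow>
      W \<noteq> {} \<and> (\<forall>u\<in>W. \<forall>v\<in>W. (u, v) \<in> rtrancl_on W ?E)"
    unfolding connected_def strongly_connected_def reachable_def verts arcs ..
  show ?thesis
  proof
    assume c: "connected (with_proj G \<restriction> W)"
    show "cut_connected (parcs G) W"
      unfolding cut_connected_def
    proof (intro conjI allI impI)
      show "W \<noteq> {}" using c conn by blast
      fix U assume U: "U \<subseteq> W \<and> U \<noteq> {} \<and> U \<noteq> W"
      then obtain u v where uv: "u \<in> U" "v \<in> W" "v \<notin> U" by blast
      show "\<exists>x\<in>U. \<exists>y\<in>W - U. (x, y) \<in> parcs G"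
      proof (rule ccontr)
        assume no: "\<not> ?thesis"
        have "(u, v) \<in> rtrancl_on W ?E" using c conn uv U by blast
        then have "v \<in> U"
          by (induct rule: rtrancl_on_induct) (use no uv in auto)
        with uv show False by blast
      qed
    qed
  next
    assume c: "cut_connected (parcs G) W"
    have "(u, v) \<in> rtrancl_on W ?E" if "u \<in> W" "v \<in> W" for u v
    proof -
      define U where "U = {x \<in> W. (u, x) \<in> rtrancl_on W ?E}"
      have "U = W"
      proof (rule ccontr)
        assume "U \<noteq> W"
        moreover have "u \<in> U" "U \<subseteq> W" using that by (auto simp: U_def)
        ultimately obtain x y where xy: "x \<in> U" "y \<in> W - U" "(x, y) \<in> parcs G"
          using c unfolding cut_connected_def by blast
        then have "(x, y) \<in> ?E" using \<open>U \<subseteq> W\<close> by blast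
        then have "(u, y) \<in> rtrancl_on W ?E"
          using xy by (auto simp: U_def intro: rtrancl_on_into_rtrancl_on)
        with xy show False by (auto simp: U_def)
      qed
      then show ?thesis using that by (auto simp: U_def)
    qed
    then show "connected (with_proj G \<restriction> W)"
      using c conn by (auto simp: cut_connected_def)
  qed
qed

lemma k_connected_iff:
  assumes "sym (parcs G)"
  shows "k_connected k G \<longleftrightarrow> card (pverts G) > k \<and>
     (\<forall>S \<subseteq> pverts G. card S < k \<longrightarrow> cut_connected (parcs G) (pverts G - S))"
  unfolding k_connected_def connected_induce_iff[OF assms] ..

text \<open>If \<open>v\<close> had fewer than \<open>k\<close> neighbours, deleting them would
  isolate \<open>v\<close>. What remains is connected, so it is \<open>v\<close> alone, and the
  graph has at most \<open>k\<close> vertices.\<close>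

lemma k_connected_min_degree:
  assumes G: "pair_graph G" and c: "k_connected k G" and v: "v \<in> pverts G"
  shows "k \<le> card (parcs G `` {v})"
proof (rule ccontr)
  let ?N = "parcs G `` {v}"
  assume less: "\<not> k \<le> card ?N"
  have fin: "finite (pverts G)" and sub: "parcs G \<subseteq> pverts G \<times> pverts G"
    and sym: "sym (parcs G)" and irr: "irrefl (parcs G)"
    using G by (auto simp: pair_graph_iff)
  have N: "?N \<subseteq> pverts G" using sub by auto
  have vN: "v \<notin> ?N" using irr by (auto simp: irrefl_def)
  have cut: "cut_connected (parcs G) (pverts G - ?N)" and card: "card (pverts G) > k"
    using c less N unfolding k_connected_iff[OF sym] by auto
  have "{v} = pverts G - ?N"
  proof (rule ccontr)
    assume "{v} \<noteq> pverts G - ?N"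
    then obtain x y where "x \<in> {v}" "y \<in> pverts G - ?N - {v}" "(x, y) \<in> parcs G"
      using cut v vN unfolding cut_connected_def by (metis DiffI empty_subsetI insert_not_empty insert_subset)
    then show False by auto
  qed
  then have "card (pverts G - ?N) = 1" by (metis is_singletonI is_singleton_altdef)
  then show False
    using card less card_Diff_subset[of ?N "pverts G"] finite_subset[OF N fin] N by simp
qed

section \<open>Lower bounds for the number of edges\<close>

lemma card_parcs_le_graph_size:
  assumes "finite (parcs G)"
  shows "card (parcs G) \<le> 2 * graph_size G"
proof -
  let ?f = "\<lambda>(u, v). {u, v}"
  \<comment> \<open>An edge comes from an arc and possibly its reversal, so the fibres of the map
    from arcs to edges have at most two elements.\<close>
  have "card {a \<in> parcs G. ?f a = e} \<le> 2" if "e \<in> ?f ` parcs G" for e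
  proof -
    obtain a where "e = ?f a" using \<open>e \<in> ?f ` parcs G\<close> by blast
    then have e: "e = {fst a, snd a}" by (simp add: case_prod_unfold)
    have "{a \<in> parcs G. ?f a = e} \<subseteq> {a, (snd a, fst a)}"
      unfolding e by (auto simp: doubleton_eq_iff)
    then have "card {a \<in> parcs G. ?f a = e} \<le> card {a, (snd a, fst a)}"
      by (rule card_mono[rotated]) simp
    also have "\<dots> \<le> 2" by (simp add: card_insert_if)
    finally show ?thesis .
  qed
  then have "(\<Sum>e\<in>?f ` parcs G. card {a \<in> parcs G. ?f a = e}) \<le> of_nat (card (?f ` parcs G)) * 2"
    by (rule sum_bounded_above)
  moreover have "card (parcs G) = (\<Sum>e\<in>?f ` parcs G. card {a \<in> parcs G. ?f a = e})"
  proof -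
    have "parcs G = (\<Union>e\<in>?f ` parcs G. {a \<in> parcs G. ?f a = e})" by auto
    then have "card (parcs G) = card (\<Union>e\<in>?f ` parcs G. {a \<in> parcs G. ?f a = e})" by simp
    also have "\<dots> = (\<Sum>e\<in>?f ` parcs G. card {a \<in> parcs G. ?f a = e})"
      by (rule card_UN_disjoint) (use assms in auto)
    finally show ?thesis .
  qed
  ultimately show ?thesis by (simp add: graph_size_def)
qed

lemma k_connected_size_ge:
  assumes G: "pair_graph G" and c: "k_connected k G"
  shows "k * card (pverts G) \<le> 2 * graph_size G"
proof -
  have fin: "finite (pverts G)" and sub: "parcs G \<subseteq> pverts G \<times> pverts G"
    using G by (auto simp: pair_graph_iff)
  then have finE: "finite (parcs G)" by (meson finite_SigmaI finite_subset)
  have "k * card (pverts G) \<le> (\<Sum>v\<in>pverts G. card (parcs G `` {v}))"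
    using sum_bounded_below[of "pverts G" k "\<lambda>v. card (parcs G `` {v})"]
      k_connected_min_degree[OF G c] by (simp add: mult.commute)
  also have "\<dots> = card (SIGMA v:pverts G. parcs G `` {v})"
    by (subst card_SigmaI) (use fin finE in \<open>auto intro: finite_Image\<close>)
  also have "(SIGMA v:pverts G. parcs G `` {v}) = parcs G"
    using sub by auto
  finally show ?thesis using card_parcs_le_graph_size[OF finE] by linarith
qed

text \<open>Growing a vertex set from a single vertex, each cut supplies an arc to a new vertex and
  hence an edge not counted before.\<close>

lemma connected_size_ge:
  assumes G: "pair_graph G" and c: "k_connected 1 G"
  shows "card (pverts G) - 1 \<le> graph_size G"
proof -
  have fin: "finite (pverts G)" and sub: "parcs G \<subseteq> pverts G \<times> pverts G"
    and sym: "sym (parcs G)"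
    using G by (auto simp: pair_graph_iff)
  have finE: "finite (parcs G)" using fin sub by (meson finite_SigmaI finite_subset)
  have cut: "cut_connected (parcs G) (pverts G)"
    using c unfolding k_connected_iff[OF sym] by (metis Diff_empty card.empty empty_subsetI less_one)
  let ?edges = "\<lambda>A. (\<lambda>(u, v). {u, v}) ` (parcs G \<inter> A \<times> A)"
  have "\<exists>A \<subseteq> pverts G. card A = Suc n \<and> n \<le> card (?edges A)"
    if "Suc n \<le> card (pverts G)" for n
    using that
  proof (induction n)
    case 0
    then obtain v where "v \<in> pverts G" by fastforce
    then show ?case by (intro exI[of _ "{v}"]) auto
  next
    case (Suc n)
    then obtain A where A: "A \<subseteq> pverts G" "card A = Suc n" "n \<le> card (?edges A)" by auto
    then have "A \<noteq> {}" "A \<noteq> pverts G" using Suc.prems by auto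
    then obtain x y where xy: "x \<in> A" "y \<in> pverts G - A" "(x, y) \<in> parcs G"
      using cut A(1) unfolding cut_connected_def by blast
    \<comment> \<open>The edge is new because its endpoint \<open>y\<close> lies outside
      \<open>A\<close>.\<close>
    have "{x, y} \<notin> ?edges A" using xy by (auto simp: doubleton_eq_iff)
    then have "Suc (card (?edges A)) = card (insert {x, y} (?edges A))"
      using finE by simp
    also have "\<dots> \<le> card (?edges (insert y A))"
      by (rule card_mono) (use finE xy in \<open>auto simp: image_iff intro!: bexI[of _ "(x, y)"]\<close>)
    finally have "Suc n \<le> card (?edges (insert y A))" using A(3) by linarith
    moreover have "card (insert y A) = Suc (Suc n)"
      using xy A finite_subset[OF A(1) fin] by simp
    ultimately show ?case using xy A(1) by (intro exI[of _ "insert y A"]) auto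
  qed
  from this[of "card (pverts G) - 1"] obtain A where
    A: "card (pverts G) - 1 \<le> card (?edges A)"
    using c by (auto simp: k_connected_def)
  also have "\<dots> \<le> graph_size G"
    unfolding graph_size_def by (rule card_mono) (use finE in auto)
  finally show ?thesis .
qed

section \<open>Joins with an independent set\<close>

text \<open>The cross edges and the edges of \<open>H\<close> are disjoint families, since only the
  former have an endpoint in \<open>S\<close>. Both the join and the decomposition below are counted
  this way.\<close>

lemma graph_size_split:
  assumes V: "pverts G = S \<union> T" "S \<inter> T = {}" "finite S" "finite T"
    and E: "parcs G = parcs H \<union> S \<times> T \<union> T \<times> S" and H: "parcs H \<subseteq> T \<times> T"
  shows "graph_size G = card S * card T + graph_size H"
proof -
  let ?f = "\<lambda>(u, v). {u, v}"
  have "?f ` parcs G = ?f ` parcs H \<union> ?f ` (S \<times> T)"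
    unfolding E by (force simp: image_iff insert_commute)
  moreover have "?f ` parcs H \<inter> ?f ` (S \<times> T) = {}"
  proof -
    have "?f x \<noteq> ?f y" if "x \<in> parcs H" "y \<in> S \<times> T" for x y
    proof -
      have "?f x \<subseteq> T" using that(1) H by (cases x) auto
      moreover have "\<not> ?f y \<subseteq> T" using that(2) V(2) by (cases y) auto
      ultimately show ?thesis by metis
    qed
    then show ?thesis unfolding disjoint_iff image_iff by metis
  qed
  moreover have "finite (parcs H)" using H V(4) by (meson finite_SigmaI finite_subset)
  moreover have "card (?f ` (S \<times> T)) = card S * card T"
    by (subst card_image) (use V(2) in \<open>auto simp: inj_on_def doubleton_eq_iff card_cartesian_product\<close>)
  ultimately show ?thesis
    unfolding graph_size_def using V(3,4) by (simp add: card_Un_disjoint)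
qed

section \<open>Maximum independent sets\<close>

lemma finite_independent_sets: "finite (pverts G) \<Longrightarrow> finite {S. independent_set G S}"
  by (rule finite_subset[of _ "Pow (pverts G)"]) (auto simp: independent_set_def)

lemma independence_number_attained:
  assumes "finite (pverts G)"
  obtains S where "independent_set G S" "card S = independence_number G"
proof -
  have "{} \<in> {S. independent_set G S}" by (simp add: independent_set_def)
  then have "independence_number G \<in> card ` {S. independent_set G S}"
    unfolding independence_number_def using finite_independent_sets[OF assms]
    by (intro Max_in) auto
  then show ?thesis using that by auto
qed

lemma independence_number_eqI:
  assumes "finite (pverts G)" "independent_set G S" "card S = n"
    and "\<And>I. independent_set G I \<Longrightarrow> card I \<le> n"
  shows "independence_number G = n"
  unfolding independence_number_def
  by (rule Max_eqI) (use assms finite_independent_sets[of G] in auto)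

text \<open>Fewer than \<open>k\<close> deletions cannot exhaust \<open>pverts H\<close>. If some
  vertex of \<open>S\<close> survives too, the surviving complete bipartite part connects
  everything; otherwise \<open>S\<close> has used up \<alpha> deletions, and the connectivity of
  \<open>H\<close> absorbs the rest.\<close>

lemma join_in_class:
  assumes H: "pair_graph H" "card (pverts H) = k" "k_connected (k - \<alpha>) H"
    and S: "finite S" "card S = \<alpha>" "S \<inter> pverts H = {}" and "0 < \<alpha>" "\<alpha> \<le> k"
  defines "G \<equiv> \<lparr>pverts = S \<union> pverts H, parcs = parcs H \<union> S \<times> pverts H \<union> pverts H \<times> S\<rparr>"
  shows "pair_graph G" "card (pverts G) = \<alpha> + k" "k_connected k G" "independence_number G = \<alpha>"
    "graph_size G = \<alpha> * k + graph_size H"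
proof -
  let ?T = "pverts H"
  have fin: "finite ?T" and sub: "parcs H \<subseteq> ?T \<times> ?T" and symH: "sym (parcs H)"
    and irr: "irrefl (parcs H)"
    using H(1) by (auto simp: pair_graph_iff)
  show G: "pair_graph G"
    using fin sub symH irr S unfolding pair_graph_iff by (auto simp: G_def sym_def irrefl_def)
  then have sym: "sym (parcs G)" and finG: "finite (pverts G)" by (auto simp: pair_graph_iff)
  show card: "card (pverts G) = \<alpha> + k"
    using S fin H(2) by (simp add: G_def card_Un_disjoint)
  show "graph_size G = \<alpha> * k + graph_size H"
    using graph_size_split[of G S ?T H] S fin sub H(2) by (simp add: G_def)
  show "k_connected k G"
    unfolding k_connected_iff[OF sym]
  proof (intro conjI allI impI)
    show "k < card (pverts G)" using card \<open>0 < \<alpha>\<close> by simp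
    fix X assume X: "X \<subseteq> pverts G" "card X < k"
    have finX: "finite X" using X finG finite_subset by blast
    have "?T - X \<noteq> {}"
      using X(2) H(2) finX card_mono[of X ?T] by auto
    then obtain t where t: "t \<in> ?T" "t \<notin> X" by blast
    show "cut_connected (parcs G) (pverts G - X)"
    proof (cases "S \<subseteq> X")
      case True
      have "card (?T \<inter> X) + \<alpha> = card ((?T \<inter> X) \<union> S)"
        using S fin by (subst card_Un_disjoint) auto
      also have "\<dots> \<le> card X" using True finX by (intro card_mono) auto
      finally have "card (?T \<inter> X) < k - \<alpha>" using X(2) by linarith
      then have "cut_connected (parcs H) (?T - (?T \<inter> X))"
        using H(3) unfolding k_connected_iff[OF symH] by blast
      moreover have "?T - (?T \<inter> X) = pverts G - X" using True by (auto simp: G_def)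
      ultimately have "cut_connected (parcs H) (pverts G - X)" by simp
      then show ?thesis
        by (rule iffD1[OF cut_connected_cong, rotated]) (use True in \<open>auto simp: G_def\<close>)
    next
      case False
      then obtain s where s: "s \<in> S" "s \<notin> X" by blast
      show ?thesis
        unfolding cut_connected_def
      proof (intro conjI allI impI)
        show "pverts G - X \<noteq> {}" using s by (auto simp: G_def)
        fix U assume U: "U \<subseteq> pverts G - X \<and> U \<noteq> {} \<and> U \<noteq> pverts G - X"
        then obtain a b where ab: "a \<in> U" "b \<in> pverts G - X - U" by blast
        have edge: "(x, y) \<in> parcs G" if "x \<in> S \<and> y \<in> ?T \<or> x \<in> ?T \<and> y \<in> S" for x y
          using that by (auto simp: G_def)
        have st: "s \<in> pverts G - X" "t \<in> pverts G - X" using s t by (auto simp: G_def)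
        have "(a \<in> S \<or> a \<in> ?T) \<and> (b \<in> S \<or> b \<in> ?T)" using ab U by (auto simp: G_def)
        \<comment> \<open>Endpoints in different parts are adjacent. If both lie in the same part,
          the survivor \<open>t\<close> or \<open>s\<close> of the other part is adjacent to both,
          so one of these two edges crosses the cut.\<close>
        then consider "a \<in> S" "b \<in> ?T" | "a \<in> ?T" "b \<in> S" | "a \<in> S" "b \<in> S" | "a \<in> ?T" "b \<in> ?T"
          by blast
        then show "\<exists>x\<in>U. \<exists>y\<in>pverts G - X - U. (x, y) \<in> parcs G"
        proof cases
          case 3
          then show ?thesis using edge ab st t(1) by (cases "t \<in> U") blast+
        next
          case 4
          then show ?thesis using edge ab st s(1) by (cases "s \<in> U") blast+
        qed (use edge ab in blast)+
      qed
    qed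
  qed
  show "independence_number G = \<alpha>"
  proof (rule independence_number_eqI[OF finG, of S])
    show "independent_set G S"
      using S(3) sub by (auto simp: independent_set_def G_def)
    show "card S = \<alpha>" by fact
    fix I assume I: "independent_set G I"
    show "card I \<le> \<alpha>"
    proof (cases "I \<subseteq> S")
      case True
      then show ?thesis using S card_mono by blast
    next
      case False
      then obtain v where v: "v \<in> I" "v \<in> ?T" using I by (auto simp: independent_set_def G_def)
      then have IT: "I \<subseteq> ?T" using I by (auto simp: independent_set_def G_def)
      \<comment> \<open>An independent set meeting \<open>?T\<close> cannot meet \<open>S\<close>,
        and it avoids the at least k - \<alpha> neighbours of \<open>v\<close> among the
        \<open>k\<close> vertices of \<open>?T\<close>.\<close>
      have "I \<subseteq> ?T - parcs H `` {v}" using I IT v by (auto simp: independent_set_def G_def)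
      then have "card I \<le> card (?T - parcs H `` {v})" using fin by (intro card_mono) auto
      also have "\<dots> = k - card (parcs H `` {v})"
        using sub fin H(2) by (subst card_Diff_subset) (auto intro: finite_subset)
      also have "\<dots> \<le> \<alpha>"
        using k_connected_min_degree[OF H(1,3) v(2)] \<open>\<alpha> \<le> k\<close> by linarith
      finally show ?thesis .
    qed
  qed
qed

lemma decompose_along_independent_set:
  assumes G: "pair_graph G" "card (pverts G) = \<alpha> + k" "k_connected k G"
    and S: "independent_set G S" "card S = \<alpha>" and \<alpha>: "0 < \<alpha>" "\<alpha> \<le> k"
  defines "H \<equiv> \<lparr>pverts = pverts G - S, parcs = parcs G \<inter> (pverts G - S) \<times> (pverts G - S)\<rparr>"
  shows "pair_graph H" "card (pverts H) = k" "k_connected (k - \<alpha>) H"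
    "graph_size G = \<alpha> * k + graph_size H"
proof -
  let ?T = "pverts G - S"
  have fin: "finite (pverts G)" and sub: "parcs G \<subseteq> pverts G \<times> pverts G"
    and symG: "sym (parcs G)" and irr: "irrefl (parcs G)"
    using G(1) by (auto simp: pair_graph_iff)
  have SV: "S \<subseteq> pverts G" using S by (simp add: independent_set_def)
  have finS: "finite S" using SV fin finite_subset by blast
  show H: "pair_graph H"
    using fin sub symG irr unfolding pair_graph_iff by (auto simp: H_def sym_def irrefl_def)
  then have symH: "sym (parcs H)" by (simp add: pair_graph_iff)
  show cardT: "card (pverts H) = k"
    using G(2) S(2) SV finS by (simp add: H_def card_Diff_subset)
  \<comment> \<open>Only \<open>k\<close> vertices lie outside \<open>S\<close>, and
    \<open>s\<close> has at least \<open>k\<close> neighbours, all of them there.\<close>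
  have full: "parcs G `` {s} = ?T" if "s \<in> S" for s
  proof (rule card_subset_eq)
    show "finite ?T" using fin by simp
    show le: "parcs G `` {s} \<subseteq> ?T" using sub S(1) that by (auto simp: independent_set_def)
    have "k \<le> card (parcs G `` {s})" using k_connected_min_degree[OF G(1,3)] SV that by blast
    moreover have "card (parcs G `` {s}) \<le> card ?T" using le fin by (intro card_mono) auto
    ultimately show "card (parcs G `` {s}) = card ?T" using cardT by (simp add: H_def)
  qed
  have E: "parcs G = parcs H \<union> S \<times> ?T \<union> ?T \<times> S"
  proof
    show "parcs G \<subseteq> parcs H \<union> S \<times> ?T \<union> ?T \<times> S"
      using sub S(1) by (auto simp: H_def independent_set_def)
    have st: "(s, t) \<in> parcs G" if "s \<in> S" "t \<in> ?T" for s t using full that by blast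
    then have "(t, s) \<in> parcs G" if "s \<in> S" "t \<in> ?T" for s t using symG that by (blast dest: symD)
    with st show "parcs H \<union> S \<times> ?T \<union> ?T \<times> S \<subseteq> parcs G" by (auto simp: H_def)
  qed
  show "graph_size G = \<alpha> * k + graph_size H"
    using graph_size_split[OF _ _ finS _ E] SV fin cardT S(2) by (auto simp: H_def)
  show "k_connected (k - \<alpha>) H"
    unfolding k_connected_iff[OF symH]
  proof (intro conjI allI impI)
    show "k - \<alpha> < card (pverts H)" using cardT \<alpha> by simp
    fix X assume X: "X \<subseteq> pverts H" "card X < k - \<alpha>"
    have XS: "X \<inter> S = {}" and finX: "finite X" using X fin by (auto simp: H_def intro: finite_subset)
    \<comment> \<open>Deleting \<open>X\<close> from \<open>H\<close> is deleting \<open>X\<close>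
      together with \<open>S\<close> from \<open>G\<close>, which costs \<alpha> further
      vertices.\<close>
    have "card (X \<union> S) < k" using X(2) S(2) finX finS XS by (simp add: card_Un_disjoint)
    moreover have "X \<union> S \<subseteq> pverts G" using X SV by (auto simp: H_def)
    ultimately have "cut_connected (parcs G) (pverts G - (X \<union> S))"
      using G(3) unfolding k_connected_iff[OF symG] by blast
    moreover have "pverts G - (X \<union> S) = pverts H - X" by (auto simp: H_def)
    ultimately have "cut_connected (parcs G) (pverts H - X)" by simp
    then show "cut_connected (parcs H) (pverts H - X)"
      by (rule iffD1[OF cut_connected_cong, rotated]) (auto simp: H_def)
  qed
qed

section \<open>Harary graphs\<close>

text \<open>A point of \<open>A\<close> strictly between the endpoints can replace \<open>a\<close>,
  a point of \<open>B\<close> can replace \<open>b\<close>; the shrinking ends at a pair with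
  nothing coloured in between.\<close>

lemma gap_between:
  fixes A B :: "int set"
  assumes "a \<in> A" "b \<in> B" "a < b"
  shows "\<exists>u v. a \<le> u \<and> u < v \<and> v \<le> b \<and> u \<in> A \<and> v \<in> B \<and> {u<..<v} \<inter> (A \<union> B) = {}"
  using assms
proof (induction "nat (b - a)" arbitrary: a b rule: less_induct)
  case less
  show ?case
  proof (cases "{a<..<b} \<inter> (A \<union> B) = {}")
    case True
    then show ?thesis using less.prems by blast
  next
    case False
    then obtain x where "x \<in> {a<..<b}" and AB: "x \<in> A \<or> x \<in> B" by blast
    then have x: "a < x" "x < b" by auto
    from AB show ?thesis
    proof
      assume "x \<in> A"
      with x less.hyps[of b x] less.prems obtain u v where "x \<le> u" "u < v" "v \<le> b" "u \<in> A" "v \<in> B"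
        "{u<..<v} \<inter> (A \<union> B) = {}" by auto
      then show ?thesis using x by (intro exI[of _ u] exI[of _ v]) simp
    next
      assume "x \<in> B"
      with x less.hyps[of x a] less.prems obtain u v where "a \<le> u" "u < v" "v \<le> x" "u \<in> A" "v \<in> B"
        "{u<..<v} \<inter> (A \<union> B) = {}" by auto
      then show ?thesis using x by (intro exI[of _ u] exI[of _ v]) simp
    qed
  qed
qed

lemma interval_one_colour:
  fixes A B :: "int set"
  assumes "a \<in> B" "\<And>x. a \<le> x \<Longrightarrow> x \<le> b \<Longrightarrow> x \<in> A \<union> B" "\<And>x. x \<in> B \<Longrightarrow> x + 1 \<notin> A"
  shows "{a..b} \<subseteq> B"
proof -
  have "x \<le> b \<longrightarrow> x \<in> B" if "a \<le> x" for x
    using that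
  proof (induction rule: int_ge_induct)
    case base
    then show ?case using assms(1) by simp
  next
    case (step i)
    then show ?case using assms(2)[of "i + 1"] assms(3)[of i] by auto
  qed
  then show ?thesis by auto
qed

text \<open>
  The sets \<open>A\<close> and \<open>B\<close> are the \<open>p\<close>-periodic lifts of the two sides of a separation of a graph on
  the integers modulo \<open>p\<close>; the integers outside \<open>A \<union> B\<close> are the lifts of the deleted vertices.
\<close>

locale periodic_separation =
  fixes A B :: "int set" and p r :: int
  assumes r_pos: "1 \<le> r"
    and disj: "A \<inter> B = {}" and A_ne: "A \<noteq> {}" and B_ne: "B \<noteq> {}"
    and periodic: "x + p \<in> A \<longleftrightarrow> x \<in> A" "x + p \<in> B \<longleftrightarrow> x \<in> B" and p_pos: "0 < p"
    and near: "\<lbrakk>1 \<le> \<delta>; \<delta> \<le> r; x \<in> A\<rbrakk> \<Longrightarrow> x + \<delta> \<notin> B" "\<lbrakk>1 \<le> \<delta>; \<delta> \<le> r; x \<in> B\<rbrakk> \<Longrightarrow> x + \<delta> \<notin> A"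
begin

text \<open>Within one period the colour changes from \<open>A\<close> to \<open>B\<close> and back.
  Each change passes an uncoloured gap, and \<open>near\<close> forces at least \<open>r\<close>
  integers into it.\<close>

lemma two_gaps:
  obtains u v v' u' where "u \<in> A" "v \<in> B" "v' \<in> B" "u' \<in> A" "u + r < v" "v \<le> v'" "v' + r < u'"
    "u' \<le> u + p" "{u<..<v} \<inter> (A \<union> B) = {}" "{v'<..<u'} \<inter> (A \<union> B) = {}"
proof -
  obtain a b where ab: "a \<in> A" "b \<in> B" using A_ne B_ne by blast
  have shift: "b + int n * p \<in> B" for n
  proof (induction n)
    case (Suc n)
    then show ?case using periodic(2)[of "b + int n * p"] by (simp add: algebra_simps)
  qed (use ab in simp)
  \<comment> \<open>Since \<open>p\<close> is at least 1, more than a - b periods carry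
    \<open>b\<close> beyond \<open>a\<close>.\<close>
  have "a < b + int (nat (a - b) + 1) * p"
    using p_pos by (smt (verit) int_nat_eq mult_le_cancel_left1 of_nat_add of_nat_1)
  then obtain b' where b': "b' \<in> B" "a < b'" using shift by blast
  obtain u v where uv: "u < v" "u \<in> A" "v \<in> B" "{u<..<v} \<inter> (A \<union> B) = {}"
    using gap_between[OF ab(1) b'] by blast
  have up: "u + p \<in> A" using periodic uv by blast
  \<comment> \<open>Otherwise the translate of \<open>u\<close>, a point of \<open>A\<close>, would
    fall into the first gap or onto \<open>v\<close>. Hence the second gap can be sought between
    \<open>v\<close> and \<open>u + p\<close>, in the same period.\<close>
  have "v < u + p"
  proof (rule ccontr)
    assume "\<not> v < u + p"
    moreover have "v \<noteq> u + p" using up uv disj by blast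
    ultimately have "u + p \<in> {u<..<v}" using p_pos by auto
    then show False using up uv by blast
  qed
  then obtain v' u' where vu: "v \<le> v'" "v' < u'" "u' \<le> u + p" "v' \<in> B" "u' \<in> A"
    "{v'<..<u'} \<inter> (B \<union> A) = {}"
    using gap_between[OF uv(3) up] by blast
  have "u + r < v" using near(1)[of "v - u" u] uv by force
  moreover have "v' + r < u'" using near(2)[of "u' - v'" v'] vu by force
  ultimately show ?thesis using that uv vu by (simp add: Un_commute)
qed

lemma card_gaps_ge:
  obtains u where "2 * r \<le> int (card ({u<..u + p} - (A \<union> B)))"
proof -
  obtain u v v' u' where g: "u \<in> A" "v \<in> B" "v' \<in> B" "u' \<in> A" "u + r < v" "v \<le> v'" "v' + r < u'"
    "u' \<le> u + p" "{u<..<v} \<inter> (A \<union> B) = {}" "{v'<..<u'} \<inter> (A \<union> B) = {}"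
    by (rule two_gaps)
  have "int (card ({u<..<v} \<union> {v'<..<u'})) = (v - u - 1) + (u' - v' - 1)"
    using g r_pos by (subst card_Un_disjoint) auto
  moreover have "card ({u<..<v} \<union> {v'<..<u'}) \<le> card ({u<..u + p} - (A \<union> B))"
    by (rule card_mono) (use g r_pos in auto)
  ultimately have "2 * r \<le> int (card ({u<..u + p} - (A \<union> B)))" using g by linarith
  then show ?thesis by (rule that)
qed

text \<open>
  If only \<open>2r\<close> vertices are deleted, they form two blocks of \<open>r\<close> consecutive ones, and both sides of
  the separation are arcs; an endpoint of the shorter arc has its antipodes in the other arc.
\<close>

lemma card_gaps_gt:
  assumes h: "r + 1 \<le> h" "2 * h \<le> p" "p \<le> 2 * h + 1"
    and far: "\<And>x. x \<in> A \<Longrightarrow> x + h \<notin> B \<or> x + p - h \<notin> B"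
      "\<And>x. x \<in> B \<Longrightarrow> x + h \<notin> A \<or> x + p - h \<notin> A"
  obtains u where "2 * r < int (card ({u<..u + p} - (A \<union> B)))"
proof -
  obtain u v v' u' where g: "u \<in> A" "v \<in> B" "v' \<in> B" "u' \<in> A" "u + r < v" "v \<le> v'" "v' + r < u'"
    "u' \<le> u + p" "{u<..<v} \<inter> (A \<union> B) = {}" "{v'<..<u'} \<inter> (A \<union> B) = {}"
    by (rule two_gaps)
  let ?D = "{u<..u + p} - (A \<union> B)"
  let ?gaps = "{u<..<v} \<union> {v'<..<u'}"
  have card: "int (card ?gaps) = (v - u - 1) + (u' - v' - 1)"
    using g r_pos by (subst card_Un_disjoint) auto
  have sub: "?gaps \<subseteq> ?D" using g r_pos by auto
  have "2 * r < int (card ?D)"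
  proof (rule ccontr)
    assume few: "\<not> 2 * r < int (card ?D)"
    have mono: "card ?gaps \<le> card ?D" by (rule card_mono[OF _ sub]) simp
    \<comment> \<open>Two gaps of at least \<open>r\<close> points each fit into at most 2r
      uncoloured ones only with equality throughout.\<close>
    then have v: "v = u + r + 1" and u': "u' = v' + r + 1" and "card ?gaps = card ?D"
      using g few card by linarith+
    then have D: "?gaps = ?D" using card_subset_eq[OF _ sub] by simp
    have B: "{v..v'} \<subseteq> B"
    proof (rule interval_one_colour[OF g(2)])
      show "x \<in> A \<union> B" if "v \<le> x" "x \<le> v'" for x
      proof -
        have "x \<notin> ?gaps" "x \<in> {u<..u + p}" using that g r_pos by auto
        then show ?thesis using D by blast
      qed
      show "x + 1 \<notin> A" if "x \<in> B" for x using near(2)[of 1 x] r_pos that by simp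
    qed
    have A: "{u'..u + p} \<subseteq> A"
    proof (rule interval_one_colour[OF g(4)])
      show "x \<in> B \<union> A" if "u' \<le> x" "x \<le> u + p" for x
      proof -
        have "x \<notin> ?gaps" "x \<in> {u<..u + p}" using that g r_pos by auto
        then show ?thesis using D by blast
      qed
      show "x + 1 \<notin> B" if "x \<in> A" for x using near(1)[of 1 x] r_pos that by simp
    qed
    show False
    proof (cases "v' - v \<le> u + p - u'")
      case True
      \<comment> \<open>The differences v' - v and u + p - u' add up to p - 2r - 2, so the smaller
        one is at most h - r - 1. A jump by \<open>h\<close> from \<open>v\<close> therefore clears
        the rest of the \<open>B\<close>-arc and the following gap.\<close>
      then have "v + h \<in> {u'..u + p}" "v + p - h \<in> {u'..u + p}"
        using h u' v by auto
      then show False using A far(2)[OF g(2)] by blast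
    next
      case False
      \<comment> \<open>The \<open>B\<close>-arc lies to the left of \<open>u'\<close>, so the
        antipodes are located one period earlier and moved back by periodicity.\<close>
      then have "u' + h - p \<in> {v..v'}" "u' - h \<in> {v..v'}"
        using h u' v by auto
      then have "u' + h \<in> B" "u' + p - h \<in> B"
        using B periodic(2)[of "u' + h - p"] periodic(2)[of "u' - h"] by (auto simp: algebra_simps)
      then show False using far(1)[OF g(4)] by blast
    qed
  qed
  then show ?thesis by (rule that)
qed

end

text \<open>
  For odd \<open>d\<close> the chords of length \<open>p div 2\<close> are taken without reduction modulo \<open>p\<close>, so that there
  are \<open>\<lceil>p/2\<rceil>\<close> of them and every vertex is on at least one.
\<close>

definition harary :: "nat \<Rightarrow> nat \<Rightarrow> nat pair_pre_digraph" where
  "harary p d = \<lparr>pverts = {..<p},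
     parcs = {(u, v). u < p \<and> v < p \<and> u \<noteq> v \<and>
       ((\<exists>\<delta>\<in>{1..d div 2}. v = (u + \<delta>) mod p \<or> u = (v + \<delta>) mod p) \<or>
        odd d \<and> (v = u + p div 2 \<or> u = v + p div 2))}\<rparr>"

lemma pair_graph_harary: "pair_graph (harary p d)"
  unfolding pair_graph_iff by (auto simp: harary_def sym_def irrefl_def)

text \<open>A short edge is charged to an endpoint and a step length, a long chord to its smaller
  endpoint, which lies below \<open>p - p div 2\<close>. Repeated charges do no harm to an upper
  bound, and the summand 1 pays for rounding when \<open>p\<close> and \<open>d\<close> are
  odd.\<close>

lemma graph_size_harary: "2 * graph_size (harary p d) \<le> d * p + 1"
proof -
  let ?r = "d div 2" and ?h = "p div 2"
  let ?near = "(\<lambda>(i, \<delta>). {i, (i + \<delta>) mod p}) ` ({..<p} \<times> {1..?r})"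
  let ?far = "(\<lambda>i. {i, i + ?h}) ` (if odd d then {..<p - ?h} else {})"
  have "(\<lambda>(u, v). {u, v}) ` parcs (harary p d) \<subseteq> ?near \<union> ?far"
  proof clarify
    fix u v
    assume uv: "(u, v) \<in> parcs (harary p d)" and nf: "{u, v} \<notin> ?far"
    have lt: "u < p" "v < p" using uv by (auto simp: harary_def)
    have "v \<noteq> u + ?h \<and> u \<noteq> v + ?h" if "odd d"
      using nf that lt by (auto simp: image_iff insert_commute)
    then obtain \<delta> where \<delta>: "\<delta> \<in> {1..?r}" "v = (u + \<delta>) mod p \<or> u = (v + \<delta>) mod p"
      using uv by (auto simp: harary_def)
    then consider "{u, v} = (\<lambda>(i, \<delta>). {i, (i + \<delta>) mod p}) (u, \<delta>)"
      | "{u, v} = (\<lambda>(i, \<delta>). {i, (i + \<delta>) mod p}) (v, \<delta>)" by (auto simp: insert_commute)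
    then show "{u, v} \<in> ?near" using lt \<delta>(1) by cases blast+
  qed
  then have "graph_size (harary p d) \<le> card (?near \<union> ?far)"
    unfolding graph_size_def by (intro card_mono) auto
  also have "\<dots> \<le> card ?near + card ?far" by (rule card_Un_le)
  also have "card ?near \<le> p * ?r"
    using card_image_le[of "{..<p} \<times> {1..?r}"] by (simp add: card_cartesian_product)
  also have "card ?far \<le> (if odd d then p - ?h else 0)"
    using card_image_le[of "{..<p - ?h}" "\<lambda>i. {i, i + ?h}"] by simp
  finally have "2 * graph_size (harary p d) \<le> 2 * (p * ?r) + 2 * (if odd d then p - ?h else 0)"
    by simp
  also have "\<dots> \<le> d * p + 1"
  proof (cases "odd d")
    case True
    then obtain m where "d = 2 * m + 1" by (elim oddE)
    moreover have "2 * (p - ?h) \<le> p + 1" by presburger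
    ultimately show ?thesis by (simp add: algebra_simps)
  next
    case False
    then obtain m where "d = 2 * m" by auto
    then show ?thesis by simp
  qed
  finally show ?thesis .
qed

text \<open>A cut without crossing arcs after deleting \<open>S\<close> lifts to a
  \<open>periodic_separation\<close>. Its uncoloured points in one period number at least 2r, and
  more than 2r for odd \<open>d\<close>; they inject into \<open>S\<close>, which has fewer than
  \<open>d\<close> elements.\<close>

lemma k_connected_harary:
  assumes d: "2 \<le> d" "d + 2 \<le> p"
  shows "k_connected d (harary p d)"
proof -
  let ?E = "parcs (harary p d)"
  have V: "pverts (harary p d) = {..<p}" by (simp add: harary_def)
  have sym: "sym ?E" using pair_graph_harary pair_graph_iff by blast
  define r h where "r = d div 2" and "h = p div 2"
  have "cut_connected ?E ({..<p} - S)" if S: "S \<subseteq> {..<p}" "card S < d" for S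
    unfolding cut_connected_def
  proof (intro conjI allI impI)
    have "card S < card {..<p}" using S d by simp
    then show "{..<p} - S \<noteq> {}" using S by auto
    fix U assume U: "U \<subseteq> {..<p} - S \<and> U \<noteq> {} \<and> U \<noteq> {..<p} - S"
    show "\<exists>x\<in>U. \<exists>y\<in>{..<p} - S - U. (x, y) \<in> ?E"
    proof (rule ccontr)
      assume no: "\<not> ?thesis"
      define res where "res x = nat (x mod int p)" for x
      have res: "res x < p" for x using d by (simp add: res_def nat_less_iff)
      have res_add: "res (x + int n) = (res x + n) mod p" for x n
        using d by (simp add: res_def nat_mod_distrib[symmetric] nat_add_distrib nat_eq_iff
            zmod_int mod_simps)
      have res_int: "res (int x) = x" if "x < p" for x using that by (simp add: res_def)
      define A B where "A = {x. res x \<in> U}" and "B = {x. res x \<in> {..<p} - S - U}"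
      have sep: "(res x, res y) \<notin> ?E \<and> (res y, res x) \<notin> ?E"
        if "x \<in> A \<and> y \<in> B \<or> x \<in> B \<and> y \<in> A" for x y
        using no that symD[OF sym] unfolding A_def B_def by blast
      have near: "\<not> (x \<in> A \<and> x + \<delta> \<in> B \<or> x \<in> B \<and> x + \<delta> \<in> A)" if "1 \<le> \<delta>" "\<delta> \<le> int r" for x \<delta>
      proof
        assume AB: "x \<in> A \<and> x + \<delta> \<in> B \<or> x \<in> B \<and> x + \<delta> \<in> A"
        obtain n where n: "\<delta> = int n"
          using \<open>1 \<le> \<delta>\<close> by (metis nonneg_int_cases order_trans zero_le_one)
        then have "n \<in> {1..d div 2}" using \<open>1 \<le> \<delta>\<close> \<open>\<delta> \<le> int r\<close> by (simp add: r_def)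
        have "res x \<noteq> res (x + \<delta>)" using AB unfolding A_def B_def by auto
        then have "(res x, res (x + \<delta>)) \<in> ?E"
          using n \<open>n \<in> {1..d div 2}\<close> res[of x] res[of "x + \<delta>"] res_add by (auto simp: harary_def)
        then show False using sep AB by blast
      qed
      obtain a b where "a \<in> U" "b \<in> {..<p} - S - U" using U by blast
      then have "int a \<in> A" "int b \<in> B" using U by (auto simp: A_def B_def res_int)
      interpret periodic_separation A B "int p" "int r"
      proof
        show "A \<inter> B = {}" by (auto simp: A_def B_def)
      qed (use d near \<open>int a \<in> A\<close> \<open>int b \<in> B\<close> in \<open>auto simp: r_def A_def B_def res_def\<close>)
      \<comment> \<open>Distinct integers in a half-open window of length \<open>p\<close> have
        distinct residues, and uncoloured ones reduce to vertices of \<open>S\<close>.\<close>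
      have window: "card ({u<..u + int p} - (A \<union> B)) \<le> card S" for u
      proof (rule card_inj_on_le[of res])
        show "inj_on res ({u<..u + int p} - (A \<union> B))"
        proof (rule inj_onI)
          fix x y assume x: "x \<in> {u<..u + int p} - (A \<union> B)" and y: "y \<in> {u<..u + int p} - (A \<union> B)"
            and "res x = res y"
          then have "x mod int p = y mod int p" using d by (simp add: res_def nat_eq_iff)
          then have "int p dvd x - y" by (simp add: mod_eq_dvd_iff)
          moreover have "\<bar>x - y\<bar> < int p" using x y by auto
          ultimately show "x = y" using dvd_imp_le_int[of "x - y" "int p"] by force
        qed
        show "res ` ({u<..u + int p} - (A \<union> B)) \<subseteq> S"
          using res by (auto simp: A_def B_def)
        show "finite S" using S finite_subset by blast
      qed
      have ge: "2 * r \<le> card S"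
      proof -
        obtain u where "2 * int r \<le> int (card ({u<..u + int p} - (A \<union> B)))"
          by (rule card_gaps_ge)
        then show ?thesis using window[of u] by linarith
      qed
      then have odd: "odd d" using S(2) by (auto simp: r_def)
      \<comment> \<open>A vertex is only sure to have one of its two possible long chords: the
        forward one if \<open>res x + h < p\<close>, the backward one otherwise. Hence both
        antipodes are required to have the opposite colour.\<close>
      have far: "\<not> (x \<in> A \<and> x + int h \<in> B \<and> x + int p - int h \<in> B \<or>
          x \<in> B \<and> x + int h \<in> A \<and> x + int p - int h \<in> A)" for x
      proof
        assume AB: "x \<in> A \<and> x + int h \<in> B \<and> x + int p - int h \<in> B \<or>
          x \<in> B \<and> x + int h \<in> A \<and> x + int p - int h \<in> A"
        have h: "0 < h" "h < p" "2 * h \<le> p" using d by (auto simp: h_def)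
        show False
        proof (cases "res x + h < p")
          case True
          then have "res (x + int h) = res x + h" using res_add by simp
          then have "(res x, res (x + int h)) \<in> ?E"
            using True odd h by (simp add: harary_def h_def)
          then show False using sep AB by blast
        next
          case False
          have eq: "x + int p - int h = x + int (p - h)" using h by (simp add: of_nat_diff)
          \<comment> \<open>Adding \<open>p - h\<close> in place of subtracting \<open>h\<close>
            keeps the increment natural, as \<open>res_add\<close> requires; the sum wraps round
            exactly once.\<close>
          have "(res x + (p - h)) mod p = (res x - h + p) mod p" using False h by simp
          also have "\<dots> = res x - h" using res[of x] by simp
          finally have "res (x + int p - int h) = res x - h" unfolding eq res_add .
          moreover have "res x - h < p" "res x \<noteq> res x - h" "res x = res x - h + h"
            using False h res[of x] by linarith+
          ultimately have "(res x, res (x + int p - int h)) \<in> ?E"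
            using odd res[of x] by (simp add: harary_def h_def[symmetric])
          then show False using sep AB by blast
        qed
      qed
      obtain u where "2 * int r < int (card ({u<..u + int p} - (A \<union> B)))"
      proof (rule card_gaps_gt[of "int h"])
        \<comment> \<open>Here d = 2r + 1, so \<open>d + 2 \<le> p\<close> gives 2r + 3 \<le> p and
          thus the first inequality.\<close>
        show "int r + 1 \<le> int h" "2 * int h \<le> int p" "int p \<le> 2 * int h + 1"
          using d odd by (auto simp: r_def h_def)
      qed (use far in blast)+
      then have "2 * r < card S" using window[of u] by linarith
      then show False using S(2) by (simp add: r_def)
    qed
  qed
  then show ?thesis using d unfolding k_connected_iff[OF sym] V by simp
qed

section \<open>The minimum sizes\<close>

lemma min_size_conn_attained:
  assumes "d < p"
  obtains G where "G \<in> conn_class p d" "graph_size G = min_size_conn p d"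
proof -
  have "min_size_conn p d \<in> graph_size ` conn_class p d"
    unfolding min_size_conn_def
    by (rule Inf_nat_def1) (use conn_class_nonempty[OF assms] in simp)
  then show ?thesis using that by auto
qed

lemma min_size_conn_le: "G \<in> conn_class p d \<Longrightarrow> min_size_conn p d \<le> graph_size G"
  unfolding min_size_conn_def by (simp add: wellorder_Inf_le1)

lemma min_size_conn_0:
  assumes "0 < p"
  shows "min_size_conn p 0 = 0"
proof -
  let ?G = "\<lparr>pverts = {..<p}, parcs = {}\<rparr>"
  have "pair_graph ?G" by (simp add: pair_graph_iff sym_def irrefl_def)
  then have "?G \<in> conn_class p 0" using assms by (simp add: conn_class_def k_connected_def)
  from min_size_conn_le[OF this] show ?thesis by (simp add: graph_size_def)
qed

text \<open>The star with centre 0 attains the lower bound for connected graphs: every cut separates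
  the centre from some leaf.\<close>

lemma min_size_conn_1:
  assumes "1 < p"
  shows "min_size_conn p 1 = p - 1"
proof (rule antisym)
  let ?G = "\<lparr>pverts = {..<p}, parcs = {0} \<times> {1..<p} \<union> {1..<p} \<times> {0}\<rparr>"
  have G: "pair_graph ?G" using assms by (auto simp: pair_graph_iff sym_def irrefl_def)
  then have sym: "sym (parcs ?G)" by (simp only: pair_graph_iff)
  have "cut_connected (parcs ?G) {..<p}"
    unfolding cut_connected_def
  proof (intro conjI allI impI)
    show "{..<p} \<noteq> {}" using assms by auto
    fix U assume U: "U \<subseteq> {..<p} \<and> U \<noteq> {} \<and> U \<noteq> {..<p}"
    then obtain a b where ab: "a \<in> U" "b \<in> {..<p} - U" by blast
    show "\<exists>x\<in>U. \<exists>y\<in>{..<p} - U. (x, y) \<in> parcs ?G"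
    proof (cases "0 \<in> U")
      case True
      moreover have "b \<noteq> 0" using True ab(2) by (intro notI) simp
      ultimately show ?thesis using ab(2) by (intro bexI[of _ 0] bexI[of _ b]) simp_all
    next
      case False
      moreover have "a \<noteq> 0" "a < p" using False ab U by auto
      ultimately show ?thesis using ab(1) by (intro bexI[of _ a] bexI[of _ 0]) simp_all
    qed
  qed
  then have "k_connected 1 ?G"
    unfolding k_connected_iff[OF sym] using assms by (auto simp: finite_subset)
  then have "?G \<in> conn_class p 1" using G by (simp add: conn_class_def)
  then have "min_size_conn p 1 \<le> graph_size ?G" by (rule min_size_conn_le)
  also have "\<dots> \<le> p - 1"
  proof -
    have "(\<lambda>(u, v). {u, v}) ` parcs ?G \<subseteq> (\<lambda>v. {0, v}) ` {1..<p}" by auto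
    then have "graph_size ?G \<le> card ((\<lambda>v. {0, v}) ` {1..<p})"
      unfolding graph_size_def by (intro card_mono) auto
    also have "\<dots> \<le> p - 1" using card_image_le[of "{1..<p}"] by simp
    finally show ?thesis .
  qed
  finally show "min_size_conn p 1 \<le> p - 1" .
next
  obtain G where "G \<in> conn_class p 1" "graph_size G = min_size_conn p 1"
    using min_size_conn_attained assms .
  then show "p - 1 \<le> min_size_conn p 1"
    using connected_size_ge[of G] by (auto simp: conn_class_def)
qed

text \<open>The lower bound is the degree count, the upper one the Harary graph. Together they fix
  the minimum as half of \<open>d * p\<close> rounded up, without mentioning ceilings.\<close>

lemma min_size_conn_bounds:
  assumes "2 \<le> d" "d + 2 \<le> p"
  shows "d * p \<le> 2 * min_size_conn p d" "2 * min_size_conn p d \<le> d * p + 1"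
proof -
  have "d < p" using assms by simp
  then obtain G where "G \<in> conn_class p d" "graph_size G = min_size_conn p d"
    by (rule min_size_conn_attained)
  then show "d * p \<le> 2 * min_size_conn p d"
    using k_connected_size_ge[of G d] by (auto simp: conn_class_def)
  have "harary p d \<in> conn_class p d"
    using pair_graph_harary k_connected_harary[OF assms]
    by (simp add: conn_class_def) (simp add: harary_def)
  then show "2 * min_size_conn p d \<le> d * p + 1"
    using min_size_conn_le[of "harary p d"] graph_size_harary[of p d] by fastforce
qed

text \<open>Joining an extremal graph of order \<open>k\<close> gives the upper bound; decomposing
  an extremal member of the class along a maximum independent set gives the lower one.\<close>

lemma min_size_indep_eq:
  assumes "0 < \<alpha>" "\<alpha> \<le> k"
  shows "conn_indep_class (\<alpha> + k) \<alpha> k \<noteq> {}"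
    and "min_size_indep (\<alpha> + k) \<alpha> k = \<alpha> * k + min_size_conn k (k - \<alpha>)"
proof -
  let ?C = "conn_indep_class (\<alpha> + k) \<alpha> k"
  have "k - \<alpha> < k" using assms by simp
  then obtain H where H: "H \<in> conn_class k (k - \<alpha>)" "graph_size H = min_size_conn k (k - \<alpha>)"
    by (rule min_size_conn_attained)
  then have H': "pair_graph H" "card (pverts H) = k" "k_connected (k - \<alpha>) H"
    by (auto simp: conn_class_def)
  \<comment> \<open>Infinitely many natural numbers remain as labels for the new independent
    vertices.\<close>
  have "infinite (UNIV - pverts H)"
    using H'(1) by (intro Diff_infinite_finite) (auto simp: pair_graph_iff)
  then obtain S where S: "finite S" "card S = \<alpha>" "S \<subseteq> UNIV - pverts H"
    using infinite_arbitrarily_large by blast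
  let ?G = "\<lparr>pverts = S \<union> pverts H, parcs = parcs H \<union> S \<times> pverts H \<union> pverts H \<times> S\<rparr>"
  have "S \<inter> pverts H = {}" using S by blast
  note join = join_in_class[OF H' S(1,2) this assms]
  have G: "?G \<in> ?C" using join by (simp add: conn_indep_class_def conn_class_def)
  then show ne: "?C \<noteq> {}" by blast
  show "min_size_indep (\<alpha> + k) \<alpha> k = \<alpha> * k + min_size_conn k (k - \<alpha>)"
  proof (rule antisym)
    show "min_size_indep (\<alpha> + k) \<alpha> k \<le> \<alpha> * k + min_size_conn k (k - \<alpha>)"
      unfolding min_size_indep_def H(2)[symmetric] join(5)[symmetric]
      using G by (simp add: wellorder_Inf_le1)
    have "min_size_indep (\<alpha> + k) \<alpha> k \<in> graph_size ` ?C"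
      unfolding min_size_indep_def by (rule Inf_nat_def1) (use ne in simp)
    then obtain F where F: "F \<in> ?C" "min_size_indep (\<alpha> + k) \<alpha> k = graph_size F" by blast
    then have F': "pair_graph F" "card (pverts F) = \<alpha> + k" "k_connected k F"
      "independence_number F = \<alpha>"
      by (auto simp: conn_indep_class_def conn_class_def)
    then have "finite (pverts F)" by (simp add: pair_graph_iff)
    then obtain I where I: "independent_set F I" "card I = \<alpha>"
      using independence_number_attained F'(4) by metis
    note dec = decompose_along_independent_set[OF F'(1-3) I assms]
    show "\<alpha> * k + min_size_conn k (k - \<alpha>) \<le> min_size_indep (\<alpha> + k) \<alpha> k"
      unfolding F(2) dec(4) using dec(1-3)
      by (intro add_left_mono min_size_conn_le) (simp add: conn_class_def)
  qed
qed

theorem theorem3p1: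
  fixes \<alpha> k :: nat
  assumes "\<alpha> \<ge> 2" and "k \<ge> 3" and "k \<ge> \<alpha>"
  shows "conn_indep_class (\<alpha> + k) \<alpha> k \<noteq> {} \<and>
    min_size_indep (\<alpha> + k) \<alpha> k = \<alpha> * k + min_size_conn k (k - \<alpha>) \<and>
    (\<alpha> = k \<longrightarrow> min_size_indep (\<alpha> + k) \<alpha> k = k\<^sup>2) \<and>
    (\<alpha> = k - 1 \<longrightarrow> min_size_indep (\<alpha> + k) \<alpha> k = k\<^sup>2 - 1) \<and>
    (2 \<le> \<alpha> \<and> \<alpha> \<le> k - 2 \<longrightarrow>
      int (min_size_indep (\<alpha> + k) \<alpha> k) = \<lceil>real (k * (\<alpha> + k)) / 2\<rceil>)"
proof (intro conjI impI)
  have "0 < \<alpha>" using assms by simp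
  note f = min_size_indep_eq[OF this assms(3)]
  show "conn_indep_class (\<alpha> + k) \<alpha> k \<noteq> {}"
    and eq: "min_size_indep (\<alpha> + k) \<alpha> k = \<alpha> * k + min_size_conn k (k - \<alpha>)"
    by (fact f)+
  show "min_size_indep (\<alpha> + k) \<alpha> k = k\<^sup>2" if "\<alpha> = k"
    unfolding eq using that assms(2) by (simp add: min_size_conn_0 power2_eq_square)
  show "min_size_indep (\<alpha> + k) \<alpha> k = k\<^sup>2 - 1" if "\<alpha> = k - 1"
  proof -
    obtain j where "k = Suc j" using assms(2) by (cases k) auto
    moreover have "k - \<alpha> = 1" "1 < k" using that assms(2) by auto
    ultimately show ?thesis
      unfolding eq using that min_size_conn_1[of k] by (simp add: power2_eq_square)
  qed
  assume "2 \<le> \<alpha> \<and> \<alpha> \<le> k - 2"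
  \<comment> \<open>The assumption \<alpha> \<ge> 2 is what puts k - \<alpha> within the range of
    the Harary bounds for order \<open>k\<close>.\<close>
  then have "2 \<le> k - \<alpha>" "k - \<alpha> + 2 \<le> k" using assms by auto
  note b = min_size_conn_bounds[OF this]
  obtain d where d: "k = \<alpha> + d" using assms(3) le_Suc_ex by blast
  have "k * (\<alpha> + k) = 2 * (\<alpha> * k) + (k - \<alpha>) * k" unfolding d by (simp add: algebra_simps)
  then have lower: "k * (\<alpha> + k) \<le> 2 * min_size_indep (\<alpha> + k) \<alpha> k"
    and upper: "2 * min_size_indep (\<alpha> + k) \<alpha> k \<le> k * (\<alpha> + k) + 1"
    unfolding eq add_mult_distrib2[of 2] mult.assoc[symmetric] using b by presburger+
  have "real (k * (\<alpha> + k)) \<le> 2 * real (min_size_indep (\<alpha> + k) \<alpha> k)"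
    "2 * real (min_size_indep (\<alpha> + k) \<alpha> k) \<le> real (k * (\<alpha> + k)) + 1"
    using lower upper by linarith+
  \<comment> \<open>An integer in the interval from x to x + 1/2 is the ceiling of x.\<close>
  then show "int (min_size_indep (\<alpha> + k) \<alpha> k) = \<lceil>real (k * (\<alpha> + k)) / 2\<rceil>"
    by (intro ceiling_unique[symmetric]) auto
qed

end
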